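(* Let $p,q\in\mathbb{Z}_+$ with $p\leq q-1$, and let $c$ with $0<c<\frac12$ be fixed. Let $a,\alpha_1,\dots,\alpha_p,\beta_1,\dots,\beta_q\in(0,+\infty)$ be arbitrary parameters. Then for all $t,x\in\mathbb{C}$ with $$|t|<c,\qquad |x|<\frac{1}{4c}-\frac12,$$ the following relation holds: $$(1-t)^{-a}\,{}_{p+2}F_{q}\left(\frac a2,\frac{a+1}{2},\alpha_1,\dots,\alpha_p;\beta_1,\dots,\beta_q;-\frac{4xt}{(1-t)^2}\right)=\sum_{n=0}^\infty\frac{(a)_n}{n!}\,\mathbf{P}_n(x;a,\alpha_1,\dots,\alpha_p;\beta_1,\dots,\beta_q)\,t^n ,$$ where $\mathbf{P}_n(x;a,\alpha_1,\dots,\alpha_p;\beta_1,\dots,\beta_q)={}_{p+2}F_q(-n,n+a,\alpha_1,\dots,\alpha_p;\beta_1,\dots,\beta_q;x)$.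
   Context: $\mathbb{Z}_+$ is the set of non-negative integers. The Pochhammer symbol is $(c)_0=1$, $(c)_k=c(c+1)\cdots(c+k-1)$ for $k\ge1$. The generalized hypergeometric function is $${}_mF_n(a_1,\dots,a_m;b_1,\dots,b_n;x)=\sum_{k=0}^\infty\frac{(a_1)_k\cdots(a_m)_k}{(b_1)_k\cdots(b_n)_k}\frac{x^k}{k!}.$$ When one of the upper parameters is $-n$ with $n\in\mathbb{Z}_+$ the series terminates and is a polynomial in $x$ (sum over $0\le k\le n$). If $p=0$, the parameters $\alpha_k$ are absent. The power $(1-t)^{-a}$ is the principal branch (equal to $1$ at $t=0$). *)

theory Defs
  imports "HOL-Analysis.Analysis"
begin

text \<open>
  The generalized hypergeometric function with upper parameters \<open>as\<close> and lower parameters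
  \<open>bs\<close>. The library's formal series \<^const>\<open>fps_hypergeo\<close> has a third argument that
  scales the variable; it is set to 1. Where the series diverges, \<^const>\<open>eval_fps\<close>
  (an infinite sum) has no meaningful value.
\<close>

definition hypergeo :: "complex list \<Rightarrow> complex list \<Rightarrow> complex \<Rightarrow> complex" where
  "hypergeo as bs z = eval_fps (fps_hypergeo as bs 1) z"

lemma foldl_pochhammer:
  "foldl (\<lambda>r a. r * pochhammer a k) s as = s * (\<Prod>a\<leftarrow>as. pochhammer a k)"
  for s :: "'a :: comm_semiring_1"
  by (induction as arbitrary: s) (simp_all add: mult.assoc)

lemma fps_hypergeo_nth_prod_list:
  "fps_nth (fps_hypergeo as bs 1) k =
     (\<Prod>a\<leftarrow>as. pochhammer a k) / (\<Prod>b\<leftarrow>bs. pochhammer b k) / fact k"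
  by (simp add: foldl_pochhammer)

lemma hypergeo_eq_suminf:
  "hypergeo as bs z =
     (\<Sum>k. (\<Prod>a\<leftarrow>as. pochhammer a k) / (\<Prod>b\<leftarrow>bs. pochhammer b k) * (z ^ k / fact k))"
  unfolding hypergeo_def eval_fps_def fps_hypergeo_nth_prod_list by simp

lemma hypergeo_terminating:
  assumes "- of_nat n \<in> set as"
  shows "hypergeo as bs z =
     (\<Sum>k\<le>n. (\<Prod>a\<leftarrow>as. pochhammer a k) / (\<Prod>b\<leftarrow>bs. pochhammer b k) * (z ^ k / fact k))"
proof -
  have "(\<Prod>a\<leftarrow>as. pochhammer a k) = 0" if "k > n" for k
  proof -
    have "pochhammer (- of_nat n :: complex) k = 0"
      using that by (simp add: pochhammer_of_nat_eq_0_iff)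
    with assms have "0 \<in> set (map (\<lambda>a. pochhammer a k) as)"
      by (metis image_eqI set_map)
    then show ?thesis by (simp add: prod_list_zero_iff)
  qed
  then show ?thesis
    unfolding hypergeo_eq_suminf by (intro suminf_finite) auto
qed

definition hypergeo_P ::
    "nat \<Rightarrow> complex \<Rightarrow> real \<Rightarrow> real list \<Rightarrow> real list \<Rightarrow> complex" where
  "hypergeo_P n x a \<alpha>s \<beta>s =
     hypergeo ((- of_nat n) # (of_nat n + of_real a) # map of_real \<alpha>s) (map of_real \<beta>s) x"

end

theory Submission
  imports Defs
begin

text \<open>
  Since \<open>(a)\<^sub>n (n + a)\<^sub>k = (a)\<^sub>n\<^sub>+\<^sub>k\<close> and \<open>(-n)\<^sub>k = (-1)^k n! / (n - k)!\<close>, the substitution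
  \<open>n = k + m\<close> turns the right-hand side into the double series with terms
  \<open>A\<^sub>k (-x t)^k / k! \<cdot> (a)\<^sub>2\<^sub>k\<^sub>+\<^sub>m / m! \<cdot> t^m\<close>. Summing over \<open>m\<close> by the binomial series yields
  \<open>(a)\<^sub>2\<^sub>k (1 - t) powr (-a - 2 k)\<close>, and \<open>(a)\<^sub>2\<^sub>k = 4^k (a/2)\<^sub>k ((a+1)/2)\<^sub>k\<close> then gives the left-hand side.
  The norms form the same double series at \<open>-\<bar>x\<bar>\<close> and \<open>\<bar>t\<bar>\<close> with \<open>A\<^sub>k\<close> replaced by \<open>\<bar>A\<^sub>k\<bar>\<close>, so the
  rearrangement is justified by \<open>4 \<bar>x\<bar> \<bar>t\<bar> / (1 - \<bar>t\<bar>)\<^sup>2 < 1\<close>, where the hypergeometric series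
  converges absolutely because \<open>p + 2 \<le> q + 1\<close>.
\<close>

section \<open>Convergence of hypergeometric series in the unit disc\<close>

lemma tendsto_shifted_quotient:
  fixes a b :: "'a :: real_normed_field"
  shows "(\<lambda>k. (a + of_nat k) / (b + of_nat k)) \<longlonglongrightarrow> 1"
proof -
  have "(\<lambda>k. (a / of_nat k + 1) / (b / of_nat k + 1)) \<longlonglongrightarrow> (0 + 1) / (0 + 1)"
    by (intro tendsto_intros lim_const_over_n) auto
  moreover have "\<forall>\<^sub>F k in sequentially.
      (a / of_nat k + 1) / (b / of_nat k + 1) = (a + of_nat k) / (b + of_nat k)"
    using eventually_gt_at_top[of 0]
  proof eventually_elim
    case (elim k)
    then have "(a / of_nat k + 1) = (a + of_nat k) / of_nat k"
      and "(b / of_nat k + 1) = (b + of_nat k) / of_nat k"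
      by (simp_all add: field_simps)
    with elim show ?case by simp
  qed
  ultimately have "(\<lambda>k. (a + of_nat k) / (b + of_nat k)) \<longlonglongrightarrow> (0 + 1) / (0 + 1)"
    by (rule Lim_transform_eventually)
  then show ?thesis by simp
qed

lemma tendsto_shifted_inverse:
  fixes b :: "'a :: real_normed_field"
  shows "(\<lambda>k. 1 / (b + of_nat k)) \<longlonglongrightarrow> 0"
  unfolding divide_inverse mult_1
  by (rule filterlim_compose[OF tendsto_inverse_0])
    (rule tendsto_add_filterlim_at_infinity[OF tendsto_const tendsto_of_nat])

text \<open>Each upper factor is paired with a lower one, and such a quotient tends to 1; every
  surplus lower factor contributes a quotient tending to 0. So the limit is 1 or 0.\<close>

lemma tendsto_shifted_prod_quotient:
  fixes as bs :: "'a :: real_normed_field list"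
  assumes "length as \<le> length bs"
  obtains L where "norm L \<le> 1"
    and "(\<lambda>k. (\<Prod>a\<leftarrow>as. a + of_nat k) / (\<Prod>b\<leftarrow>bs. b + of_nat k)) \<longlonglongrightarrow> L"
  using assms
proof (induction bs arbitrary: as thesis)
  case Nil
  then show ?case by (intro Nil.prems(1)[of 1]) auto
next
  case (Cons b bs)
  show ?case
  proof (cases as)
    case Nil
    obtain L where L: "norm L \<le> 1"
      "(\<lambda>k. (\<Prod>a\<leftarrow>[]. a + of_nat k) / (\<Prod>b\<leftarrow>bs. b + of_nat k)) \<longlonglongrightarrow> L"
      using Cons.IH[of "[]"] by auto
    have "(\<lambda>k. 1 / (b + of_nat k) * ((\<Prod>a\<leftarrow>[]. a + of_nat k) / (\<Prod>b\<leftarrow>bs. b + of_nat k)))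
            \<longlonglongrightarrow> 0 * L"
      by (intro tendsto_mult tendsto_shifted_inverse L)
    with Nil show ?thesis by (intro Cons.prems(1)[of 0]) simp_all
  next
    case (Cons a as')
    obtain L where L: "norm L \<le> 1"
      "(\<lambda>k. (\<Prod>a\<leftarrow>as'. a + of_nat k) / (\<Prod>b\<leftarrow>bs. b + of_nat k)) \<longlonglongrightarrow> L"
      using Cons.IH[of as'] Cons.prems(2) Cons by auto
    have "(\<lambda>k. (a + of_nat k) / (b + of_nat k) *
              ((\<Prod>a\<leftarrow>as'. a + of_nat k) / (\<Prod>b\<leftarrow>bs. b + of_nat k))) \<longlonglongrightarrow> 1 * L"
      by (intro tendsto_mult tendsto_shifted_quotient L)
    with L Cons show ?thesis by (intro Cons.prems(1)[of L]) simp_all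
  qed
qed

lemma prod_list_pochhammer_Suc:
  fixes as :: "'a :: comm_semiring_1 list"
  shows "(\<Prod>a\<leftarrow>as. pochhammer a (Suc k)) = (\<Prod>a\<leftarrow>as. pochhammer a k) * (\<Prod>a\<leftarrow>as. a + of_nat k)"
  by (induction as) (simp_all add: pochhammer_Suc mult_ac)

text \<open>The extra lower parameter \<open>1\<close> accounts for the factorial in the denominator.\<close>

lemma fps_hypergeo_nth_Suc:
  fixes as bs :: "complex list"
  shows "fps_nth (fps_hypergeo as bs 1) (Suc k) = fps_nth (fps_hypergeo as bs 1) k *
      ((\<Prod>a\<leftarrow>as. a + of_nat k) / (\<Prod>b\<leftarrow>1 # bs. b + of_nat k))"
  unfolding fps_hypergeo_nth_prod_list prod_list_pochhammer_Suc by simp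

text \<open>Ratio test: the quotient of consecutive terms tends to \<open>L * z\<close>, where
  \<open>norm L \<le> 1\<close>. The length condition leaves room for the lower parameter 1 that
  comes from the factorial.\<close>

lemma abs_summable_fps_hypergeo:
  fixes as bs :: "complex list"
  assumes len: "length as \<le> Suc (length bs)" and z: "norm z < 1"
  shows "summable (\<lambda>k. norm (fps_nth (fps_hypergeo as bs 1) k * z ^ k))"
proof -
  define f where "f k = fps_nth (fps_hypergeo as bs 1) k * z ^ k" for k
  define r where "r k = (\<Prod>a\<leftarrow>as. a + of_nat k) / (\<Prod>b\<leftarrow>1 # bs. b + of_nat k)" for k
  obtain L where L: "norm L \<le> 1" "r \<longlonglongrightarrow> L"
    unfolding r_def using tendsto_shifted_prod_quotient[of as "1 # bs"] len by auto
  have "norm (L * z) < 1"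
    using mult_right_mono[OF L(1), of "norm z"] z by (simp add: norm_mult)
  then obtain d where d: "norm (L * z) < d" "d < 1"
    using dense by blast
  have "(\<lambda>k. norm (r k * z)) \<longlonglongrightarrow> norm (L * z)"
    by (intro tendsto_intros L)
  then have "\<forall>\<^sub>F k in sequentially. norm (r k * z) < d"
    using d by (intro order_tendstoD)
  then obtain N where N: "norm (r k * z) < d" if "k \<ge> N" for k
    by (auto simp: eventually_sequentially)
  have "norm (f (Suc k)) \<le> d * norm (f k)" if "k \<ge> N" for k
  proof -
    have "f (Suc k) = (r k * z) * f k"
      unfolding f_def r_def fps_hypergeo_nth_Suc by (simp add: mult_ac)
    then show ?thesis
      using N[OF that] by (simp only: norm_mult[of "r k * z"]) (intro mult_right_mono, auto)
  qed
  then have "summable (\<lambda>k. norm (f k))"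
    using d(2) by (intro summable_ratio_test[of d N]) auto
  then show ?thesis by (simp add: f_def)
qed

section \<open>Binomial series and Pochhammer identities\<close>

lemma gbinomial_minus_mult_power:
  fixes a t :: "'a :: field_char_0"
  shows "(- a gchoose m) * (- t) ^ m = pochhammer a m / fact m * t ^ m"
  using power_mult_distrib[of "-1" "- t" m]
  by (simp add: gbinomial_pochhammer mult.left_commute)

text \<open>Factoring \<open>pochhammer a l\<close> out of \<open>pochhammer a (l + m)\<close>
  leaves the binomial series with exponent \<open>- (a + l)\<close>. Its integer part is split off
  as an ordinary power, to be merged later with the hypergeometric argument.\<close>

lemma pochhammer_binomial_sums:
  fixes a t :: complex
  assumes "norm t < 1"
  shows "(\<lambda>m. pochhammer a (l + m) / fact m * t ^ m) sums
           (pochhammer a l * ((1 - t) powr (- a) / (1 - t) ^ l))"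
proof -
  have t: "t \<noteq> 1" using assms by auto
  have "(\<lambda>m. pochhammer a l * ((- (a + of_nat l) gchoose m) * (- t) ^ m)) sums
          (pochhammer a l * (1 + (- t)) powr (- (a + of_nat l)))"
    using assms by (intro sums_mult gen_binomial_complex) simp
  also have "(\<lambda>m. pochhammer a l * ((- (a + of_nat l) gchoose m) * (- t) ^ m)) =
               (\<lambda>m. pochhammer a (l + m) / fact m * t ^ m)"
    by (simp only: gbinomial_minus_mult_power pochhammer_product') (simp add: mult.assoc)
  also have "(1 + (- t)) powr (- (a + of_nat l)) = (1 - t) powr (- a) / (1 - t) ^ l"
    using t powr_diff[of "1 - t" "- a" "of_nat l"] by (simp add: powr_nat')
  finally show ?thesis .
qed

text \<open>This real version evaluates the sums of norms in the majorant series.\<close>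

lemma pochhammer_binomial_sums_real:
  fixes a t :: real
  assumes "\<bar>t\<bar> < 1"
  shows "(\<lambda>m. pochhammer a (l + m) / fact m * t ^ m) sums
           (pochhammer a l * ((1 - t) powr (- a) / (1 - t) ^ l))"
proof -
  have t: "1 - t > 0" using assms by auto
  have "(\<lambda>m. pochhammer a l * ((- (a + of_nat l) gchoose m) * (- t) ^ m)) sums
          (pochhammer a l * (1 + (- t)) powr (- (a + of_nat l)))"
    using assms by (intro sums_mult gen_binomial_real) simp
  also have "(\<lambda>m. pochhammer a l * ((- (a + of_nat l) gchoose m) * (- t) ^ m)) =
               (\<lambda>m. pochhammer a (l + m) / fact m * t ^ m)"
    by (simp only: gbinomial_minus_mult_power pochhammer_product') (simp add: mult.assoc)
  also have "(1 + (- t)) powr (- (a + of_nat l)) = (1 - t) powr (- a) / (1 - t) ^ l"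
    using t powr_diff[of "1 - t" "- a" "of_nat l"] by (simp add: powr_realpow)
  finally show ?thesis .
qed

lemma pochhammer_minus_of_nat:
  assumes "k \<le> n"
  shows "pochhammer (- of_nat n :: 'a :: field_char_0) k = (- 1) ^ k * fact n / fact (n - k)"
proof -
  have "(of_nat n gchoose k :: 'a) = fact n / (fact k * fact (n - k))"
    using assms by (simp flip: binomial_gbinomial add: binomial_fact)
  then have "(- 1) ^ k * pochhammer (- of_nat n :: 'a) k = fact n / fact (n - k)"
    by (simp add: gbinomial_pochhammer field_simps)
  \<comment> \<open>A second sign factor cancels the first one on the left.\<close>
  then have "(- 1) ^ k * ((- 1) ^ k * pochhammer (- of_nat n :: 'a) k) =
      (- 1) ^ k * (fact n / fact (n - k))"
    by simp
  then show ?thesis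
    by (simp flip: mult.assoc power_mult_distrib)
qed

text \<open>The result involves only \<open>n + k\<close> and \<open>n - k\<close>, which become
  \<open>2 * k + m\<close> and \<open>m\<close> for \<open>n = k + m\<close>.\<close>

lemma pochhammer_terminating:
  fixes a :: "'a :: field_char_0"
  assumes "k \<le> n"
  shows "pochhammer a n / fact n * (pochhammer (- of_nat n) k * pochhammer (of_nat n + a) k) =
           (- 1) ^ k * pochhammer a (n + k) / fact (n - k)"
  using assms by (simp add: pochhammer_minus_of_nat pochhammer_product' add.commute[of _ a])

section \<open>Summation of double series along antidiagonals\<close>

lemma has_sum_antidiagonal:
  fixes F :: "nat \<times> nat \<Rightarrow> 'a :: {topological_comm_monoid_add,t3_space}"
  assumes "(F has_sum S) UNIV"
  shows "(\<lambda>n. \<Sum>k\<le>n. F (k, n - k)) sums S"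
proof -
  \<comment> \<open>The map from \<open>(n, k)\<close> to \<open>(k, n - k)\<close> is a bijection
    from the triangle \<open>k \<le> n\<close> onto the grid.\<close>
  have "((\<lambda>(n, k). F (k, n - k)) has_sum S) (Sigma UNIV (\<lambda>n. {..n})) \<longleftrightarrow> (F has_sum S) UNIV"
    by (rule has_sum_reindex_bij_witness[of _ "\<lambda>(k, m). (k + m, k)" "\<lambda>(n, k). (k, n - k)"]) auto
  with assms have "((\<lambda>(n, k). F (k, n - k)) has_sum S) (Sigma UNIV (\<lambda>n. {..n}))"
    by blast
  then have "((\<lambda>n. \<Sum>k\<le>n. F (k, n - k)) has_sum S) UNIV"
    by (rule has_sum_SigmaD) (simp add: has_sum_finite)
  then show ?thesis by (rule has_sum_imp_sums)
qed

text \<open>Summable row sums of norms make the family absolutely summable on the grid. Its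
  unconditional sum can then be computed by rows, which gives \<open>S\<close>, and by
  antidiagonals.\<close>

lemma sums_antidiagonal:
  fixes F :: "nat \<Rightarrow> nat \<Rightarrow> 'a :: banach"
  assumes inner_norm: "\<And>k. (\<lambda>m. norm (F k m)) sums B k" and "summable B"
    and inner: "\<And>k. F k sums G k" and outer: "G sums S"
  shows "(\<lambda>n. \<Sum>k\<le>n. F k (n - k)) sums S"
proof -
  have B: "((\<lambda>m. norm (F k m)) has_sum B k) UNIV" for k
    using inner_norm by (rule sums_nonneg_imp_has_sum) simp
  have B_nonneg: "B k \<ge> 0" for k
    using B by (rule has_sum_nonneg) simp
  have "(\<lambda>p. norm (case_prod F p)) summable_on (UNIV \<times> UNIV)"
  proof (rule Infinite_Sum.abs_summable_on_Sigma_iff[THEN iffD2], intro conjI ballI)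
    show "(\<lambda>m. norm (case_prod F (k, m))) summable_on UNIV" for k
      using B[of k] by (auto simp: summable_on_def)
    show "(\<lambda>k. norm (\<Sum>\<^sub>\<infinity>m. norm (case_prod F (k, m)))) summable_on UNIV"
      using B_nonneg \<open>summable B\<close>
      by (simp add: infsumI[OF B] summable_on_UNIV_nonneg_real_iff)
  qed
  then have "case_prod F summable_on (UNIV \<times> UNIV)"
    by (rule abs_summable_summable)
  then obtain T where T: "(case_prod F has_sum T) (UNIV \<times> UNIV)"
    by (auto simp: summable_on_def)
  have "(G has_sum T) UNIV"
  proof (rule has_sum_SigmaD[OF T])
    show "((\<lambda>m. case_prod F (k, m)) has_sum G k) UNIV" for k
      using norm_summable_imp_has_sum[OF sums_summable[OF inner_norm] inner] by simp
  qed
  then have "T = S"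
    using has_sum_imp_sums outer sums_unique2 by blast
  with has_sum_antidiagonal[of "case_prod F" T] T show ?thesis by simp
qed

section \<open>The generating function as a rearranged double series\<close>

theorem theorem1:
  fixes p q :: nat and c a :: real and \<alpha>s \<beta>s :: "real list" and t x :: complex
  assumes "int p \<le> int q - 1"
    and "0 < c" and "c < 1 / 2"
    and "length \<alpha>s = p" and "length \<beta>s = q"
    and "a > 0" and "\<forall>\<alpha>\<in>set \<alpha>s. \<alpha> > 0" and "\<forall>\<beta>\<in>set \<beta>s. \<beta> > 0"
    and "norm t < c" and "norm x < 1 / (4 * c) - 1 / 2"
  shows
    "summable (\<lambda>k. fps_nth (fps_hypergeo
         (of_real (a / 2) # of_real ((a + 1) / 2) # map of_real \<alpha>s) (map of_real \<beta>s) 1) k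
       * (- (4 * x * t) / (1 - t)\<^sup>2) ^ k) \<and>
     (\<lambda>n. of_real (pochhammer a n / fact n) * hypergeo_P n x a \<alpha>s \<beta>s * t ^ n) sums
       ((1 - t) powr (- of_real a) *
        hypergeo (of_real (a / 2) # of_real ((a + 1) / 2) # map of_real \<alpha>s)
          (map of_real \<beta>s) (- (4 * x * t) / (1 - t)\<^sup>2))"
proof -
  define as :: "complex list" where
    "as = of_real (a / 2) # of_real ((a + 1) / 2) # map of_real \<alpha>s"
  define bs :: "complex list" where "bs = map of_real \<beta>s"
  define C where "C k = fps_nth (fps_hypergeo as bs 1) k" for k
  define A where "A k = (\<Prod>a\<leftarrow>map of_real \<alpha>s. pochhammer a k) / (\<Prod>b\<leftarrow>bs. pochhammer b k)"
    for k :: nat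
  \<comment> \<open>\<open>F k m\<close> is what the \<open>k\<close>-th summand of the terminating
    series contributes to the term of degree \<open>n = k + m\<close> in \<open>t\<close>.\<close>
  define F where "F k m = A k / fact k * (- x * t) ^ k *
      (pochhammer (of_real a) (2 * k + m) / fact m * t ^ m)" for k m
  \<comment> \<open>\<open>w\<close> is the hypergeometric argument at \<open>- norm x\<close> and
    \<open>norm t\<close>.\<close>
  define w where "w = 4 * norm x * norm t / (1 - norm t)\<^sup>2"
  have t: "norm t < 1" "t \<noteq> 1" and len: "length as \<le> Suc (length bs)"
    using assms by (auto simp: as_def bs_def)

  \<comment> \<open>The bound on \<open>norm x\<close> amounts to
    \<open>4 * norm x * c < 1 - 2 * c\<close>, and \<open>1 - 2 * c\<close> falls short of
    \<open>(1 - c)\<^sup>2\<close> by the square of \<open>c\<close>.\<close>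
  have "4 * norm x * norm t \<le> 4 * norm x * c"
    using assms by (intro mult_left_mono) auto
  also have "\<dots> < 1 - 2 * c"
    using assms by (simp add: field_simps)
  also have "\<dots> \<le> (1 - c)\<^sup>2"
    by (simp add: power2_eq_square algebra_simps)
  also have "\<dots> \<le> (1 - norm t)\<^sup>2"
    using assms by (intro power_mono) auto
  finally have w: "w < 1" "w \<ge> 0"
    using t by (simp_all add: w_def)
  have "norm ((1 - t)\<^sup>2) \<ge> (1 - norm t)\<^sup>2"
    using t norm_triangle_ineq2[of 1 t] by (auto simp: norm_power intro!: power_mono)
  then have "norm (- (4 * x * t) / (1 - t)\<^sup>2) \<le> w"
    using t unfolding w_def norm_divide by (intro frac_le) (auto simp: norm_mult)
  with w have "summable (\<lambda>k. norm (C k * (- (4 * x * t) / (1 - t)\<^sup>2) ^ k))"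
    unfolding C_def by (intro abs_summable_fps_hypergeo len) simp
  then have summable: "summable (\<lambda>k. C k * (- (4 * x * t) / (1 - t)\<^sup>2) ^ k)"
    by (rule summable_norm_cancel)

  \<comment> \<open>Duplication at \<open>a / 2\<close> supplies the two upper parameters missing
    from \<open>A\<close>.\<close>
  have double: "pochhammer (of_real a) (2 * k) * (A k / fact k) = 4 ^ k * C k" for k
    using pochhammer_double[of "complex_of_real a / 2" k]
    unfolding C_def fps_hypergeo_nth_prod_list A_def as_def
    by (simp add: power_mult add_divide_distrib)

  have "(\<lambda>n. \<Sum>k\<le>n. F k (n - k)) sums
      ((1 - t) powr (- of_real a) * hypergeo as bs (- (4 * x * t) / (1 - t)\<^sup>2))"
  proof (rule sums_antidiagonal)
    fix k
    have "F k sums (A k / fact k * (- x * t) ^ k * (pochhammer (of_real a) (2 * k) *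
        ((1 - t) powr (- of_real a) / (1 - t) ^ (2 * k))))"
      unfolding F_def by (intro sums_mult pochhammer_binomial_sums t)
    also have "A k / fact k * (- x * t) ^ k * (pochhammer (of_real a) (2 * k) *
        ((1 - t) powr (- of_real a) / (1 - t) ^ (2 * k))) =
      (pochhammer (of_real a) (2 * k) * (A k / fact k)) *
        ((1 - t) powr (- of_real a) * ((- x * t) ^ k / ((1 - t)\<^sup>2) ^ k))"
      by (simp add: power_mult)
    also have "\<dots> = (1 - t) powr (- of_real a) * (C k * (4 ^ k * (- x * t) ^ k / ((1 - t)\<^sup>2) ^ k))"
      unfolding double by simp
    also have "4 ^ k * (- x * t) ^ k / ((1 - t)\<^sup>2) ^ k = (- (4 * x * t) / (1 - t)\<^sup>2) ^ k"
      by (simp add: mult.assoc flip: power_mult_distrib power_divide)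
    finally show "F k sums ((1 - t) powr (- of_real a) * (C k * (- (4 * x * t) / (1 - t)\<^sup>2) ^ k))" .
  next
    show "(\<lambda>k. (1 - t) powr (- of_real a) * (C k * (- (4 * x * t) / (1 - t)\<^sup>2) ^ k)) sums
        ((1 - t) powr (- of_real a) * hypergeo as bs (- (4 * x * t) / (1 - t)\<^sup>2))"
      unfolding hypergeo_def eval_fps_def C_def[symmetric]
      by (intro sums_mult summable_sums summable)
  next
    fix k
    \<comment> \<open>Positivity of \<open>a\<close> makes these symbols equal to their norms, so
      the norms in row \<open>k\<close> again form a binomial series, now at
      \<open>norm t\<close>.\<close>
    have norm_poch: "norm (pochhammer (complex_of_real a) n) = pochhammer a n" for n
      using pochhammer_nonneg[OF \<open>a > 0\<close>, of n] by (simp add: pochhammer_of_real)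
    have "(\<lambda>m. norm (A k / fact k) * (norm x * norm t) ^ k *
            (pochhammer a (2 * k + m) / fact m * norm t ^ m)) sums
          (norm (A k / fact k) * (norm x * norm t) ^ k * (pochhammer a (2 * k) *
            ((1 - norm t) powr (- a) / (1 - norm t) ^ (2 * k))))"
      using t by (intro sums_mult pochhammer_binomial_sums_real) simp
    also have "(\<lambda>m. norm (A k / fact k) * (norm x * norm t) ^ k *
            (pochhammer a (2 * k + m) / fact m * norm t ^ m)) = (\<lambda>m. norm (F k m))"
      unfolding F_def norm_mult norm_divide norm_power norm_poch by (simp add: norm_mult)
    also have "norm (A k / fact k) * (norm x * norm t) ^ k * (pochhammer a (2 * k) *
            ((1 - norm t) powr (- a) / (1 - norm t) ^ (2 * k))) =
        norm (pochhammer (of_real a) (2 * k) * (A k / fact k)) *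
            ((1 - norm t) powr (- a) * ((norm x * norm t) ^ k / ((1 - norm t)\<^sup>2) ^ k))"
      by (simp only: norm_mult norm_poch power_mult[of _ 2 k])
        (simp only: times_divide_eq_right mult_ac)
    also have "\<dots> = (1 - norm t) powr (- a) *
        (norm (C k) * (4 ^ k * (norm x * norm t) ^ k / ((1 - norm t)\<^sup>2) ^ k))"
      unfolding double by (simp add: norm_mult norm_power)
    also have "4 ^ k * (norm x * norm t) ^ k / ((1 - norm t)\<^sup>2) ^ k = w ^ k"
      by (simp only: w_def power_divide power_mult_distrib mult.assoc)
    finally show "(\<lambda>m. norm (F k m)) sums ((1 - norm t) powr (- a) * (norm (C k) * w ^ k))" .
  next
    \<comment> \<open>The row sums of norms are, up to a constant factor, the norms of the
      hypergeometric terms at \<open>w < 1\<close>.\<close>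
    have "summable (\<lambda>k. norm (C k * of_real w ^ k))"
      unfolding C_def using w by (intro abs_summable_fps_hypergeo len) simp
    then show "summable (\<lambda>k. (1 - norm t) powr (- a) * (norm (C k) * w ^ k))"
      using w by (intro summable_mult) (simp add: norm_mult norm_power)
  qed
  also have "(\<lambda>n. \<Sum>k\<le>n. F k (n - k)) =
      (\<lambda>n. of_real (pochhammer a n / fact n) * hypergeo_P n x a \<alpha>s \<beta>s * t ^ n)"
  proof
    fix n
    have F: "F k (n - k) = of_real (pochhammer a n / fact n) *
        (pochhammer (- of_nat n) k * pochhammer (of_nat n + of_real a) k * A k * (x ^ k / fact k)) * t ^ n"
      if "k \<le> n" for k
    proof -
      have tn: "t ^ n = t ^ k * t ^ (n - k)" and nk: "n + k = 2 * k + (n - k)"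
        using that by (simp_all flip: power_add)
      have "of_real (pochhammer a n / fact n) *
          (pochhammer (- of_nat n) k * pochhammer (of_nat n + of_real a) k * A k * (x ^ k / fact k)) * t ^ n
        = pochhammer (of_real a) n / fact n *
          (pochhammer (- of_nat n) k * pochhammer (of_nat n + of_real a) k) *
          (A k * (x ^ k / fact k)) * t ^ n"
        by (simp add: pochhammer_of_real)
      also have "\<dots> = (- 1) ^ k * pochhammer (of_real a) (n + k) / fact (n - k) *
          (A k * (x ^ k / fact k)) * t ^ n"
        unfolding pochhammer_terminating[OF that] ..
      also have "\<dots> = F k (n - k)"
        unfolding tn nk using power_mult_distrib[of "- x" t k] power_minus[of x k]
        by (simp add: F_def mult_ac)
      finally show ?thesis ..
    qed
    \<comment> \<open>The upper parameter \<open>-n\<close> cuts the series at \<open>k = n\<close>,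
      so its summands match the entries of the \<open>n\<close>-th antidiagonal.\<close>
    have "hypergeo_P n x a \<alpha>s \<beta>s = (\<Sum>k\<le>n. pochhammer (- of_nat n) k *
        pochhammer (of_nat n + of_real a) k * A k * (x ^ k / fact k))"
      unfolding hypergeo_P_def by (subst hypergeo_terminating[of n]) (simp_all add: A_def bs_def mult.assoc)
    then show "(\<Sum>k\<le>n. F k (n - k)) =
        of_real (pochhammer a n / fact n) * hypergeo_P n x a \<alpha>s \<beta>s * t ^ n"
      by (simp add: F sum_distrib_left sum_distrib_right)
  qed
  finally show ?thesis
    using summable unfolding C_def as_def bs_def by blast
qed

end
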